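(* Let $n\ge2$, $d\ge1$ and $\mathbf k=(k_1,\dots,k_d)\in[n-1]^d$. Suppose $(M_1|t_1,\dots,M_d|t_d)$ and $(N_1|t_1,\dots,N_d|t_d)$ both lie in $\mathbb U_{\mathbf k}$. If $$g(M_1|t_1)g(M_2|t_2)\cdots g(M_d|t_d)=g(N_1|t_1)g(N_2|t_2)\cdots g(N_d|t_d),$$ then $M_i=N_i$ for all $i$.
   Context: Notation. Fix $n\ge2$; $[m]=\{1,\dots,m\}$, $[i,j]=\{m\in\mathbb Z: i\le m\le j\}$. For $k\in[n-1]$, $\mathbb X_k=\mathrm{Gr}(k,n)\times\mathbb C^\times$, with points written $N|t$. A subspace $N\in\mathrm{Gr}(k,n)$ is the column span of a full-rank $n\times k$ matrix, and $P_J(N)$ is the maximal minor of that matrix with row set $J$ (rows in increasing order), defined up to a common nonzero scalar. Index sets of integers are reduced modulo $n$ to subsets of $[n]$, and $P_I:=0$ if the reduced set does not have exactly $k$ elements. $\lambda$ is an indeterminate. For $N|t\in\mathbb X_k$, $g(N|t)\in\mathrm{GL}_n(\mathbb C(\lambda))$ is the matrix with entries $g(N|t)_{ij}=c_{ij}\,P_{[j-k+1,j-1]\cup\{i\}}(N)/P_{[j-k,j-1]}(N)$, where $c_{ij}=1$ if $j\le k$; $c_{ij}=t$ if $j>k$ and $i\ge j$; $c_{ij}=\lambda$ if $j>k$ and $i<j$ (defined when the denominators are nonzero). A point $N|t\in\mathbb X_k$ is positive if $t>0$ and $P_J(N)>0$ for all $k$-subsets $J$ of $[n]$ (for a suitable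 common rescaling of the Plücker coordinates). $\mathbb U_{\mathbf k}\subset\mathbb X_{k_1}\times\cdots\times\mathbb X_{k_d}$ is the set of $(N_1|t_1,\dots,N_d|t_d)$ such that each $N_i|t_i$ is positive and the $t_i$ are distinct. *)

theory Defs
  imports
    "Jordan_Normal_Form.DL_Rank_Submatrix"
    "HOL-Computational_Algebra.Polynomial_Factorial"
    "HOL-Library.FuncSet"
    Complex_Main
begin

text \<open>Matrices and vectors of the library are indexed from 0, whereas all index sets below
  (row sets of minors, the indices of the entries of \<open>g_entry\<close>) are 1-based.\<close>

definition Gr :: "nat \<Rightarrow> nat \<Rightarrow> complex vec set set" where
  "Gr k n = {N. VectorSpace.subspace class_ring N (module_vec TYPE(complex) n) \<and>
                vectorspace.dim class_ring (module_vec TYPE(complex) n\<lparr>carrier := N\<rparr>) = k}"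

definition spans :: "nat \<Rightarrow> nat \<Rightarrow> complex mat \<Rightarrow> complex vec set \<Rightarrow> bool" where
  "spans n k A N \<longleftrightarrow>
     A \<in> carrier_mat n k \<and> vec_space.rank n A = k \<and> vec_space.col_space n A = N"

definition minor :: "complex mat \<Rightarrow> nat set \<Rightarrow> complex" where
  "minor A J = det (submatrix A {i. Suc i \<in> J} UNIV)"

text \<open>The Pluecker coordinates are only defined up to a common nonzero scalar; the scalar is fixed
  here by choosing a matrix spanning \<open>N\<close>. Such a matrix exists for every \<open>N \<in> Gr k n\<close>
  (\<open>Gr_iff_spans\<close>), and quotients of coordinates do not depend on the choice
  (\<open>plucker_scaling\<close>).\<close>

definition plucker :: "nat \<Rightarrow> nat \<Rightarrow> complex vec set \<Rightarrow> nat set \<Rightarrow> complex" where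
  "plucker n k N J = minor (SOME A. spans n k A N) J"

definition residue :: "nat \<Rightarrow> int \<Rightarrow> nat" where
  "residue n m = nat ((m - 1) mod int n) + 1"

definition plucker_mod :: "nat \<Rightarrow> nat \<Rightarrow> complex vec set \<Rightarrow> int set \<Rightarrow> complex" where
  "plucker_mod n k N I =
     (if card (residue n ` I) = k then plucker n k N (residue n ` I) else 0)"

type_synonym point = "complex vec set \<times> complex"

definition XX :: "nat \<Rightarrow> nat \<Rightarrow> point set" where
  "XX n k = Gr k n \<times> {t. t \<noteq> 0}"

abbreviation const :: "complex \<Rightarrow> complex poly fract" where
  "const a \<equiv> to_fract [:a:]"

abbreviation lam :: "complex poly fract" where
  "lam \<equiv> to_fract [:0, 1:]"

definition coeff_c :: "nat \<Rightarrow> complex \<Rightarrow> nat \<Rightarrow> nat \<Rightarrow> complex poly fract" where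
  "coeff_c k t i j = (if j \<le> k then 1 else if i \<ge> j then const t else lam)"

text \<open>Division by zero yields 0 in the library, so this is meaningful only where the denominators
  are nonzero, in particular at positive points.\<close>

definition g_entry :: "nat \<Rightarrow> nat \<Rightarrow> point \<Rightarrow> nat \<Rightarrow> nat \<Rightarrow> complex poly fract" where
  "g_entry n k p i j = coeff_c k (snd p) i j *
     const (plucker_mod n k (fst p) ({int j - int k + 1 .. int j - 1} \<union> {int i}) /
            plucker_mod n k (fst p) {int j - int k .. int j - 1})"

definition g_mat :: "nat \<Rightarrow> nat \<Rightarrow> point \<Rightarrow> complex poly fract mat" where
  "g_mat n k p = mat n n (\<lambda>(i, j). g_entry n k p (Suc i) (Suc j))"

definition g_prod :: "nat \<Rightarrow> nat \<Rightarrow> (nat \<Rightarrow> nat) \<Rightarrow> (nat \<Rightarrow> point) \<Rightarrow> complex poly fract mat" where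
  "g_prod n d k p = foldr (*) (map (\<lambda>i. g_mat n (k i) (p i)) [1..<Suc d]) (1\<^sub>m n)"

definition pos_real :: "complex \<Rightarrow> bool" where
  "pos_real z \<longleftrightarrow> z \<in> \<real> \<and> 0 < Re z"

definition positive :: "nat \<Rightarrow> nat \<Rightarrow> point \<Rightarrow> bool" where
  "positive n k p \<longleftrightarrow> pos_real (snd p) \<and>
     (\<exists>c. c \<noteq> 0 \<and> (\<forall>J. J \<subseteq> {1..n} \<and> card J = k \<longrightarrow> pos_real (c * plucker n k (fst p) J)))"

definition UU :: "nat \<Rightarrow> nat \<Rightarrow> (nat \<Rightarrow> nat) \<Rightarrow> (nat \<Rightarrow> point) set" where
  "UU n d k = {p \<in> (\<Pi>\<^sub>E i\<in>{1..d}. XX n (k i)).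
     (\<forall>i\<in>{1..d}. positive n (k i) (p i)) \<and> inj_on (\<lambda>i. snd (p i)) {1..d}}"

lemma submatrix_mult_rows:
  fixes A B :: "complex mat"
  assumes "A \<in> carrier_mat n k" "B \<in> carrier_mat k k"
  shows "submatrix (A * B) I UNIV = submatrix A I UNIV * B"
proof (rule eq_matI)
  have fin: "pick I i < n" if "i < card {i. i < n \<and> i \<in> I}" for i
    using pick_le[OF that] .
  show "dim_row (submatrix (A * B) I UNIV) = dim_row (submatrix A I UNIV * B)"
    "dim_col (submatrix (A * B) I UNIV) = dim_col (submatrix A I UNIV * B)"
    using assms by (auto simp: dim_submatrix)
  fix i j
  assume "i < dim_row (submatrix A I UNIV * B)" "j < dim_col (submatrix A I UNIV * B)"
  then have i: "i < card {i. i < n \<and> i \<in> I}" and j: "j < k"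
    using assms by (auto simp: dim_submatrix)
  have r: "row (submatrix A I UNIV) i = row A (pick I i)"
    using row_submatrix_UNIV i assms by auto
  have s: "submatrix (A * B) I UNIV $$ (i, j) = (A * B) $$ (pick I i, pick UNIV j)"
    by (rule submatrix_index) (use i j assms in auto)
  show "submatrix (A * B) I UNIV $$ (i, j) = (submatrix A I UNIV * B) $$ (i, j)"
    unfolding s pick_UNIV using i j assms fin[OF i] by (simp add: r dim_submatrix)
qed

lemma minor_mult:
  assumes "A \<in> carrier_mat n k" "B \<in> carrier_mat k k" "J \<subseteq> {1..n}" "card J = k"
  shows "minor (A * B) J = minor A J * det B"
proof -
  have "J = Suc ` {i. i < n \<and> Suc i \<in> J}"
  proof (intro equalityI subsetI)
    fix x assume "x \<in> J"
    then show "x \<in> Suc ` {i. i < n \<and> Suc i \<in> J}"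
      using assms(3) by (cases x) (auto simp: image_iff)
  qed auto
  then have "card {i. i < n \<and> Suc i \<in> J} = k"
    using assms(4) card_image[of Suc "{i. i < n \<and> Suc i \<in> J}"] by simp
  then have "submatrix A {i. Suc i \<in> J} UNIV \<in> carrier_mat k k"
    using assms(1) by (intro carrier_matI) (auto simp: dim_submatrix)
  then show ?thesis
    unfolding minor_def using submatrix_mult_rows[OF assms(1,2)] assms(2) by (simp add: det_mult)
qed

lemma Gr_iff_spans: "N \<in> Gr k n \<longleftrightarrow> (\<exists>A. spans n k A N)"
proof -
  interpret vec_space "TYPE(complex)" n .
  show ?thesis
  proof
    assume "N \<in> Gr k n"
    then have sub: "VectorSpace.subspace class_ring N V" and dim: "vectorspace.dim class_ring (vs N) = k"
      by (auto simp: Gr_def)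
    then interpret W: vectorspace class_ring "vs N"
      using subspace_is_vs by blast
    have NV: "N \<subseteq> carrier V"
      using sub unfolding VectorSpace.subspace_def submodule_def by blast
    have smod: "submodule class_ring N V"
      using sub unfolding VectorSpace.subspace_def by blast
    have "\<exists>T. finite T \<and> maximal T (\<lambda>T. T \<subseteq> N \<and> lin_indpt T)"
    proof (rule maximal_exists)
      show "finite T \<and> card T \<le> dim" if "T \<subseteq> N \<and> lin_indpt T" for T
      proof -
        have c: "T \<subseteq> carrier_vec n" and l: "lin_indpt T"
          using subset_trans[OF conjunct1[OF that] NV] conjunct2[OF that] by simp_all
        show ?thesis
          using li_le_dim[OF fin_dim c l] by (rule conjI)
      qed
      show "{} \<subseteq> N \<and> lin_indpt {}"
        unfolding lin_dep_def by auto
    qed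
    then obtain T where fT: "finite T" and T: "maximal T (\<lambda>T. T \<subseteq> N \<and> lin_indpt T)"
      by blast
    have TN: "T \<subseteq> N" and liT: "lin_indpt T"
      using T unfolding maximal_def by blast+
    have TV: "T \<subseteq> carrier_vec n"
      using subset_trans[OF TN NV] by simp
    have "N \<subseteq> span T"
    proof
      fix v assume v: "v \<in> N"
      then have vV: "v \<in> carrier_vec n"
        using NV by auto
      show "v \<in> span T"
      proof (cases "v \<in> T")
        case True
        then show ?thesis by (rule subsetD[OF in_own_span[OF TV]])
      next
        case False
        then have "lin_dep (T \<union> {v})"
          using T TN v unfolding maximal_def by blast
        then show ?thesis
          using lin_dep_iff_in_span[OF TV liT _ False] vV by (metis (no_types))
      qed
    qed
    then have spanT: "span T = N"
      using span_is_subset[OF TN smod] by auto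
    then have "W.fin_dim"
      unfolding W.fin_dim_def using fT TN span_li_not_depend(1)[OF TN smod] by auto
    then obtain S where fS: "finite S" and S: "W.basis S"
      using W.finite_basis_exists by auto
    then have SN: "S \<subseteq> N" and Sspan: "W.span S = N" and card: "card S = k"
      using W.dim_basis[OF fS S] dim unfolding W.basis_def by auto
    have spanS: "span S = N"
      using span_li_not_depend(1)[OF SN smod] Sspan by auto
    obtain xs where xs: "set xs = S" "distinct xs"
      using finite_distinct_list[OF fS] by auto
    define A where "A = mat_of_cols n xs"
    have cols: "cols A = xs"
      unfolding A_def using xs SN NV by (intro cols_mat_of_cols) auto
    have "A \<in> carrier_mat n k"
      unfolding A_def using xs card distinct_card by fastforce
    moreover have "rank A = k"
      unfolding rank_def cols xs spanS dim ..
    moreover have "col_space A = N"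
      unfolding col_space_def cols xs spanS ..
    ultimately show "\<exists>A. spans n k A N"
      unfolding spans_def by auto
  next
    assume "\<exists>A. spans n k A N"
    then obtain A where A: "A \<in> carrier_mat n k" "rank A = k" and N: "col_space A = N"
      unfolding spans_def by auto
    have "set (cols A) \<subseteq> carrier V"
      using cols_dim[of A] A(1) by simp
    then have "VectorSpace.subspace class_ring N V"
      using span_is_subspace N unfolding col_space_def by auto
    moreover have "vectorspace.dim class_ring (vs N) = k"
      using A(2) N unfolding rank_def col_space_def by simp
    ultimately show "N \<in> Gr k n"
      by (simp add: Gr_def)
  qed
qed

lemma col_space_subset_factor:
  fixes A B :: "complex mat"
  assumes "A \<in> carrier_mat n k" "B \<in> carrier_mat n k"
    "vec_space.col_space n B \<subseteq> vec_space.col_space n A"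
  obtains C where "C \<in> carrier_mat k k" "B = A * C"
proof -
  interpret vec_space "TYPE(complex)" n .
  have "\<exists>x \<in> carrier_vec k. A *\<^sub>v x = col B j" if "j < k" for j
  proof -
    have cB: "set (cols B) \<subseteq> carrier_vec n" and jB: "col B j \<in> set (cols B)"
      using assms(2) that cols_dim by (auto simp: cols_def)
    then have "col B j \<in> col_space B"
      unfolding col_space_def using subsetD[OF in_own_span[OF cB]] by simp
    then show ?thesis
      using assms col_space_eq[OF assms(1)] by auto
  qed
  then obtain f where f: "\<And>j. j < k \<Longrightarrow> f j \<in> carrier_vec k \<and> A *\<^sub>v f j = col B j"
    by metis
  define C where "C = mat_of_cols k (map f [0..<k])"
  have C: "C \<in> carrier_mat k k"
    unfolding C_def by (simp add: mat_of_cols_def)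
  have "B = A * C"
  proof (rule mat_col_eqI)
    fix j assume "j < dim_col (A * C)"
    then have j: "j < k"
      using C by simp
    then have "col C j = f j"
      unfolding C_def using f by (subst col_mat_of_cols) auto
    then show "col B j = col (A * C) j"
      using f[OF j] col_mult2[OF assms(1) C j] by simp
  qed (use assms C in auto)
  with C that show ?thesis by blast
qed

lemma plucker_scaling:
  assumes "spans n k A N"
  shows "\<exists>c. c \<noteq> 0 \<and> (\<forall>J. J \<subseteq> {1..n} \<and> card J = k \<longrightarrow> plucker n k N J = c * minor A J)"
proof -
  define B where "B = (SOME A. spans n k A N)"
  have "spans n k B N"
    unfolding B_def using assms by (rule someI)
  then have AB: "A \<in> carrier_mat n k" "B \<in> carrier_mat n k"
    "vec_space.col_space n A = vec_space.col_space n B"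
    using assms by (auto simp: spans_def)
  obtain C where C: "C \<in> carrier_mat k k" "B = A * C"
    using col_space_subset_factor[OF AB(1,2) eq_refl[OF AB(3)[symmetric]]] .
  obtain D where D: "D \<in> carrier_mat k k" "A = B * D"
    using col_space_subset_factor[OF AB(2,1) eq_refl[OF AB(3)]] .
  have BA: "minor B J = minor A J * det C" and AB': "minor A J = minor B J * det D"
    if "J \<subseteq> {1..n}" "card J = k" for J
    using minor_mult[OF AB(1) C(1) that] minor_mult[OF AB(2) D(1) that] by (simp_all flip: C(2) D(2))
  show ?thesis
  proof (cases "det C = 0")
    case True
    then have "minor B J = 0 \<and> minor A J = 0" if "J \<subseteq> {1..n}" "card J = k" for J
      using BA[OF that] AB'[OF that] by auto
    then show ?thesis
      unfolding plucker_def B_def[symmetric] by (intro exI[of _ 1]) auto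
  next
    case False
    then show ?thesis
      unfolding plucker_def B_def[symmetric] using BA by (intro exI[of _ "det C"]) auto
  qed
qed

end

theory Submission
  imports Defs
begin

text \<open>
  A product of matrices \<open>g(N|t)\<close> remembers its factors because each factor degenerates at a place
  of its own. Put \<open>c = (-1)^(k-1) t\<close>. Every column of \<open>g(N|t)\<close> lists, up to a scalar and up to signs, the
  minors of a matrix spanning \<open>N\<close> in which one row index runs while \<open>k - 1\<close> others stay fixed;
  by Laplace expansion such a signed list is a vector of \<open>N\<close>. The reordering signs are constant
  along a column, except in the columns carrying \<open>t\<close> and \<open>\<lambda>\<close>, where they
  differ by the factor \<open>(-1)^(k-1)\<close> between the entries with \<open>t\<close> and those with \<open>\<lambda>\<close>. The
  specialization \<open>\<lambda> = c\<close> compensates exactly that, so all columns of \<open>g(N|t)\<close> at \<open>c\<close> lie in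
  \<open>N\<close> (\<open>g_at_factor\<close>).

  At \<open>\<lambda> = 0\<close> the matrix is lower triangular with nonzero diagonal (\<open>det_g_at_0\<close>). As the matrix
  is affine in \<open>\<lambda>\<close> and its first \<open>k\<close> columns do not involve \<open>\<lambda>\<close>, these two
  specializations control all others: the column space at \<open>c\<close> is exactly \<open>N\<close>, and
  at every other complex number the matrix is invertible (\<open>pencil_col_space_and_det\<close>,
  \<open>g_at_spectral\<close>).

  Since the \<open>t\<^sub>i\<close> are distinct and positive, the numbers \<open>c\<^sub>i = (-1)^(k\<^sub>i-1) t\<^sub>i\<close> are distinct: their
  absolute values are the \<open>t\<^sub>i\<close>. At \<open>c\<^sub>1\<close> all factors but the first are
  invertible, so the column space of the product at \<open>c\<^sub>1\<close> is the first subspace. Cancelling the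
  first factor, which is possible at every point other than \<open>c\<^sub>1\<close>, leaves an equality of shorter products
  away from \<open>c\<^sub>1\<close>, in particular at \<open>c\<^sub>2\<close>, and the argument repeats. Equality outside finitely
  many points is all that is ever used, so the cancellation takes place among complex matrices.
\<close>

section \<open>Minors as coordinates of vectors in a column space\<close>

lemma pick_insert_new:
  "i \<notin> S \<Longrightarrow> pick (insert i S) (card {s \<in> S. s < i}) = i"
proof -
  have "{s \<in> insert i S. s < i} = {s \<in> S. s < i}" by auto
  then show ?thesis using pick_card_in_set[of i "insert i S"] by simp
qed

text \<open>Row \<open>r\<close> of the smaller submatrix is found in the larger one after skipping the position of the
  new row; \<open>insert_index\<close> is the map used when expanding determinants, so that deleting the new row gives
  back the rows in \<open>S\<close>.\<close>
lemma pick_insert_old: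
  assumes "finite S" "i \<notin> S" "r < card S"
  shows "pick (insert i S) (insert_index (card {s \<in> S. s < i}) r) = pick S r"
proof -
  let ?x = "pick S r"
  have x: "?x \<in> S" using assms by (simp add: pick_in_set)
  have r: "card {s \<in> S. s < ?x} = r" using assms by (simp add: card_pick)
  have "insert_index (card {s \<in> S. s < i}) r = card {s \<in> insert i S. s < ?x}"
  proof (cases "?x < i")
    case True
    have "?x \<in> {s \<in> S. s < i} - {s \<in> S. s < ?x}" using True x by simp
    moreover have "{s \<in> S. s < ?x} \<subseteq> {s \<in> S. s < i}" using True by auto
    ultimately have "card {s \<in> S. s < ?x} < card {s \<in> S. s < i}"
      using assms(1) by (intro psubset_card_mono) auto
    then have "r < card {s \<in> S. s < i}" using r by simp
    moreover have "{s \<in> insert i S. s < ?x} = {s \<in> S. s < ?x}" using True by auto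
    ultimately show ?thesis using r by (simp add: insert_index_def)
  next
    case False
    then have ix: "i < ?x" using x assms(2) by (metis nat_neq_iff)
    then have "card {s \<in> S. s < i} \<le> card {s \<in> S. s < ?x}"
      using assms(1) by (intro card_mono) auto
    then have "card {s \<in> S. s < i} \<le> r" using r by simp
    moreover have "{s \<in> insert i S. s < ?x} = insert i {s \<in> S. s < ?x}" using ix by auto
    ultimately show ?thesis using r assms(1,2) by (simp add: insert_index_def)
  qed
  then show ?thesis using pick_card_in_set[of ?x "insert i S"] x by simp
qed

text \<open>Expanding along the row \<open>i\<close> gives \<open>(-1)^p\<close> times a linear form in that row whose
  coefficients \<open>w\<close> are signed minors of the rows in \<open>S\<close> alone, where \<open>p\<close> is the position at
  which \<open>i\<close> is inserted. The same linear form takes the value 0 on a row already in \<open>S\<close>, since it then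
  computes, up to sign, a determinant with a repeated row.\<close>
lemma minors_as_column_vector:
  fixes A :: "complex mat"
  assumes A: "A \<in> carrier_mat n k" and S: "S \<subseteq> {..<n}" and k: "Suc (card S) = k"
  obtains w where "w \<in> carrier_vec k"
    and "\<And>i. i \<in> S \<Longrightarrow> (A *\<^sub>v w) $ i = 0"
    and "\<And>i. i < n \<Longrightarrow> i \<notin> S \<Longrightarrow>
      det (submatrix A (insert i S) UNIV) = (-1) ^ card {s \<in> S. s < i} * (A *\<^sub>v w) $ i"
proof -
  have fin: "finite S" using S finite_subset by blast
  define D where "D l = mat (card S) (card S) (\<lambda>(r, c). A $$ (pick S r, insert_index l c))" for l
  define w where "w = vec k (\<lambda>l. (-1) ^ l * det (D l))"
  have w: "w \<in> carrier_vec k" by (simp add: w_def)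
  have expand: "det B = (-1) ^ p * (A *\<^sub>v w) $ i"
    if B: "B \<in> carrier_mat k k" and p: "p < k" and i: "i < n"
      and new: "\<And>l. l < k \<Longrightarrow> B $$ (p, l) = A $$ (i, l)"
      and old: "\<And>r l. r < card S \<Longrightarrow> l < k \<Longrightarrow> B $$ (insert_index p r, l) = A $$ (pick S r, l)"
    for B p i
  proof -
    have "mat_delete B p l = D l" if l: "l < k" for l
    proof (rule eq_matI)
      fix r c assume "r < dim_row (D l)" "c < dim_col (D l)"
      then have rc: "r < card S" "c < card S" by (auto simp: D_def)
      have "insert_index l c < k" using rc k by (auto simp: insert_index_def)
      moreover have "mat_delete B p l $$ (r, c) = B $$ (insert_index p r, insert_index l c)"
        using mat_delete_index[of B "card S" p l r c] B p l rc k by simp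
      ultimately show "mat_delete B p l $$ (r, c) = D l $$ (r, c)"
        using rc by (simp add: D_def old)
    qed (use B k in \<open>auto simp: D_def\<close>)
    then have "det B = (\<Sum>l<k. A $$ (i, l) * ((-1) ^ (p + l) * det (D l)))"
      using laplace_expansion_row[OF B p] by (simp add: cofactor_def new)
    also have "\<dots> = (-1) ^ p * (\<Sum>l<k. A $$ (i, l) * w $ l)"
      by (simp add: sum_distrib_left w_def power_add mult_ac)
    also have "(\<Sum>l<k. A $$ (i, l) * w $ l) = (A *\<^sub>v w) $ i"
      using A i w by (simp add: scalar_prod_def atLeast0LessThan)
    finally show ?thesis .
  qed
  show thesis
  proof (rule that[OF w])
    fix i assume i: "i \<in> S"
    then have iN: "i < n" using S by auto
    \<comment> \<open>The rows of \<open>S\<close> followed by row \<open>i\<close>, which therefore occurs twice.\<close>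
    let ?B = "mat k k (\<lambda>(r, l). A $$ (if r < card S then pick S r else i, l))"
    let ?q = "card {s \<in> S. s < i}"
    have q: "?q < card S" using i fin by (intro psubset_card_mono) auto
    have "row ?B ?q = row ?B (card S)"
      using q k pick_card_in_set[OF i] by (intro eq_vecI) auto
    then have "det ?B = 0"
      using q k by (intro det_identical_rows[of _ k ?q "card S"]) auto
    moreover have "det ?B = (-1) ^ card S * (A *\<^sub>v w) $ i"
      using iN k by (intro expand) (auto simp: insert_index_def)
    ultimately show "(A *\<^sub>v w) $ i = 0" by simp
  next
    fix i assume i: "i < n" "i \<notin> S"
    let ?B = "submatrix A (insert i S) UNIV"
    let ?p = "card {s \<in> S. s < i}"
    have "{a. a < n \<and> a \<in> insert i S} = insert i S" using i S by auto
    then have card: "card {a. a < n \<and> a \<in> insert i S} = k" using i fin k by simp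
    have entry: "?B $$ (r, l) = A $$ (pick (insert i S) r, l)" if "r < k" "l < k" for r l
      using submatrix_index[of r A "insert i S" l UNIV] that A card by (simp add: pick_UNIV)
    have p: "?p < k" using k card_mono[OF fin, of "{s \<in> S. s < i}"] by auto
    show "det ?B = (-1) ^ ?p * (A *\<^sub>v w) $ i"
    proof (rule expand[OF _ p i(1)])
      show "?B \<in> carrier_mat k k"
        using A card by (intro carrier_matI) (simp_all add: dim_submatrix)
      show "?B $$ (?p, l) = A $$ (i, l)" if "l < k" for l
        using entry[OF p that] pick_insert_new[OF i(2)] by simp
      show "?B $$ (insert_index ?p r, l) = A $$ (pick S r, l)" if "r < card S" "l < k" for r l
        using entry[of "insert_index ?p r" l] that k pick_insert_old[OF fin i(2) that(1)]
        by (simp add: insert_index_def)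
    qed
  qed
qed

lemma signed_minors_in_column_space:
  assumes A: "A \<in> carrier_mat n k" and S: "S \<subseteq> {1..n}" and k: "Suc (card S) = k"
  obtains w where "w \<in> carrier_vec k"
    and "\<And>i. i < n \<Longrightarrow> (A *\<^sub>v w) $ i =
      (if Suc i \<in> S then 0 else (-1) ^ card {s \<in> S. s < Suc i} * minor A (insert (Suc i) S))"
proof -
  define T where "T = {a. Suc a \<in> S}"
  have ST: "S = Suc ` T"
  proof (intro equalityI subsetI)
    fix x assume "x \<in> S"
    then show "x \<in> Suc ` T" using S by (cases x) (auto simp: T_def)
  qed (auto simp: T_def)
  have T: "T \<subseteq> {..<n}" using S by (auto simp: T_def)
  have cT: "Suc (card T) = k" using k ST card_image[of Suc T] by simp
  obtain w where w: "w \<in> carrier_vec k"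
    "\<And>i. i \<in> T \<Longrightarrow> (A *\<^sub>v w) $ i = 0"
    "\<And>i. i < n \<Longrightarrow> i \<notin> T \<Longrightarrow>
      det (submatrix A (insert i T) UNIV) = (-1) ^ card {s \<in> T. s < i} * (A *\<^sub>v w) $ i"
    using minors_as_column_vector[OF A T cT] by blast
  show thesis
  proof (rule that[OF w(1)])
    fix i assume i: "i < n"
    show "(A *\<^sub>v w) $ i =
      (if Suc i \<in> S then 0 else (-1) ^ card {s \<in> S. s < Suc i} * minor A (insert (Suc i) S))"
    proof (cases "Suc i \<in> S")
      case True
      then show ?thesis using w(2)[of i] by (simp add: T_def)
    next
      case False
      then have iT: "i \<notin> T" by (simp add: T_def)
      have "{s \<in> S. s < Suc i} = Suc ` {s \<in> T. s < i}" unfolding ST by auto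
      then have c: "card {s \<in> S. s < Suc i} = card {s \<in> T. s < i}"
        by (simp add: card_image)
      have "{a. Suc a \<in> insert (Suc i) S} = insert i T" by (auto simp: T_def)
      then have "minor A (insert (Suc i) S) = (-1) ^ card {s \<in> T. s < i} * (A *\<^sub>v w) $ i"
        using w(3)[OF i iT] by (simp add: minor_def)
      then show ?thesis using False c by (simp flip: mult.assoc power_add)
    qed
  qed
qed

section \<open>Linear algebra of matrix pencils\<close>

lemma col_space_mult_subset:
  fixes A B :: "complex mat"
  assumes A: "A \<in> carrier_mat n m" and B: "B \<in> carrier_mat m l"
  shows "vec_space.col_space n (A * B) \<subseteq> vec_space.col_space n A"
proof -
  interpret vec_space "TYPE(complex)" n .
  have AB: "A * B \<in> carrier_mat n l" using A B by simp
  show ?thesis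
  proof
    fix y assume "y \<in> col_space (A * B)"
    then obtain x where x: "x \<in> carrier_vec l" "(A * B) *\<^sub>v x = y"
      using A B unfolding col_space_eq[OF AB] by auto
    have "A *\<^sub>v (B *\<^sub>v x) = y" using assoc_mult_mat_vec[OF A B x(1)] x(2) by simp
    then show "y \<in> col_space A"
      unfolding col_space_eq[OF A] using A B x by (intro CollectI conjI bexI[of _ "B *\<^sub>v x"]) auto
  qed
qed

lemma nonsingular_inverse:
  fixes A :: "complex mat"
  assumes "A \<in> carrier_mat n n" "det A \<noteq> 0"
  obtains B where "B \<in> carrier_mat n n" "A * B = 1\<^sub>m n" "B * A = 1\<^sub>m n"
  using det_non_zero_imp_unit[OF assms] unfolding Units_def ring_mat_def by auto

lemma col_space_mult_nonsingular:
  fixes G X :: "complex mat"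
  assumes G: "G \<in> carrier_mat n n" and X: "X \<in> carrier_mat n n" and det: "det X \<noteq> 0"
  shows "vec_space.col_space n (G * X) = vec_space.col_space n G"
proof -
  obtain Y where Y: "Y \<in> carrier_mat n n" "X * Y = 1\<^sub>m n"
    using nonsingular_inverse[OF X det] by metis
  have GX: "G * X \<in> carrier_mat n n" using G X by simp
  have "G = (G * X) * Y" using assoc_mult_mat[OF G X Y(1)] Y(2) G by simp
  then show ?thesis
    using col_space_mult_subset[OF G X] col_space_mult_subset[OF GX Y(1)] by simp
qed

lemma mult_left_cancel_nonsingular:
  fixes G X Y :: "complex mat"
  assumes G: "G \<in> carrier_mat n n" and det: "det G \<noteq> 0"
    and X: "X \<in> carrier_mat n n" and Y: "Y \<in> carrier_mat n n" and eq: "G * X = G * Y"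
  shows "X = Y"
proof -
  obtain H where H: "H \<in> carrier_mat n n" "H * G = 1\<^sub>m n"
    using nonsingular_inverse[OF G det] by metis
  have "X = H * (G * X)" using assoc_mult_mat[OF H(1) G X] H(2) X by simp
  also have "\<dots> = Y" using assoc_mult_mat[OF H(1) G Y] H(2) Y eq by simp
  finally show ?thesis .
qed

text \<open>Let \<open>G0\<close> and \<open>G1\<close> agree on the \<open>k\<close>-dimensional image of \<open>E\<close>, where \<open>G1\<close> factors through
  \<open>k\<close> dimensions and \<open>G0\<close> is invertible. Then \<open>G1\<close> has rank \<open>k\<close>, so \<open>G0\<inverse> G1\<close> is the identity on
  the image of \<open>E\<close> and maps everything into it: it is a projection \<open>C\<close>. Hence
  \<open>s G0 + (1 - s) G1 = G0 (s + (1 - s) C)\<close>, and the last factor has only the eigenvalues \<open>1\<close> and \<open>s\<close>.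
  In the proof \<open>C = F Z\<close>, where \<open>F\<close> is a section of \<open>Z\<close> with values in the image of \<open>E\<close>.\<close>
lemma pencil_col_space_and_det:
  fixes G0 G1 A E Z :: "complex mat"
  assumes G0: "G0 \<in> carrier_mat n n" and A: "A \<in> carrier_mat n k" and Z: "Z \<in> carrier_mat k n"
    and E: "E \<in> carrier_mat n k" and G1: "G1 = A * Z" and agree: "G0 * E = G1 * E"
    and inj: "\<And>w. w \<in> carrier_vec k \<Longrightarrow> E *\<^sub>v w = 0\<^sub>v n \<Longrightarrow> w = 0\<^sub>v k"
    and G0_reg: "det G0 \<noteq> 0"
  shows "\<exists>F \<in> carrier_mat n k. A = G1 * F"
    and "s \<noteq> 0 \<Longrightarrow> det (s \<cdot>\<^sub>m G0 + (1 - s) \<cdot>\<^sub>m G1) \<noteq> 0"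
proof -
  have G1c: "G1 \<in> carrier_mat n n" using A Z G1 by simp
  define W where "W = Z * E"
  have W: "W \<in> carrier_mat k k" using Z E by (simp add: W_def)
  have AW: "A * W = G0 * E"
    unfolding W_def agree G1 using assoc_mult_mat[OF A Z E] by simp
  have "det W \<noteq> 0"
  proof
    assume "det W = 0"
    then obtain v where v: "v \<in> carrier_vec k" "v \<noteq> 0\<^sub>v k" "W *\<^sub>v v = 0\<^sub>v k"
      using det_0_iff_vec_prod_zero_field[OF W] by auto
    have "G0 *\<^sub>v (E *\<^sub>v v) = A *\<^sub>v (W *\<^sub>v v)"
      using assoc_mult_mat_vec[OF G0 E v(1)] assoc_mult_mat_vec[OF A W v(1)] AW by simp
    also have "\<dots> = 0\<^sub>v n" using A v(3) by (intro eq_vecI) auto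
    finally have "E *\<^sub>v v = 0\<^sub>v n"
      using G0_reg det_0_iff_vec_prod_zero_field[OF G0] E v(1) by (metis mult_mat_vec_carrier)
    with inj v show False by blast
  qed
  then obtain W' where W': "W' \<in> carrier_mat k k" "W * W' = 1\<^sub>m k" "W' * W = 1\<^sub>m k"
    using W det_non_zero_imp_unit[OF W] unfolding Units_def ring_mat_def by auto
  define F where "F = E * W'"
  have F: "F \<in> carrier_mat n k" using E W' by (simp add: F_def)
  have ZF: "Z * F = 1\<^sub>m k"
    unfolding F_def using assoc_mult_mat[OF Z E W'(1)] W' by (simp add: W_def)
  have GF: "G0 * F = G1 * F"
    unfolding F_def using assoc_mult_mat[OF G0 E W'(1)] assoc_mult_mat[OF G1c E W'(1)] agree by simp
  have AF: "A = G1 * F"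
    unfolding G1 using assoc_mult_mat[OF A Z F] ZF A by simp
  then show "\<exists>F \<in> carrier_mat n k. A = G1 * F" using F by blast
  show "det (s \<cdot>\<^sub>m G0 + (1 - s) \<cdot>\<^sub>m G1) \<noteq> 0" if s: "s \<noteq> 0"
  proof
    let ?G = "s \<cdot>\<^sub>m G0 + (1 - s) \<cdot>\<^sub>m G1"
    assume "det ?G = 0"
    moreover have "?G \<in> carrier_mat n n" using G0 G1c by simp
    ultimately obtain x where x: "x \<in> carrier_vec n" "x \<noteq> 0\<^sub>v n" "?G *\<^sub>v x = 0\<^sub>v n"
      using det_0_iff_vec_prod_zero_field by blast
    define y where "y = Z *\<^sub>v x"
    have y: "y \<in> carrier_vec k" using Z x by (simp add: y_def)
    have Fy: "F *\<^sub>v y \<in> carrier_vec n" using F y by simp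
    have G1x: "G1 *\<^sub>v x = G0 *\<^sub>v (F *\<^sub>v y)"
    proof -
      have "G1 *\<^sub>v x = A *\<^sub>v y" unfolding G1 y_def using assoc_mult_mat_vec[OF A Z x(1)] by simp
      also have "\<dots> = (G0 * F) *\<^sub>v y" unfolding GF AF[symmetric] ..
      also have "\<dots> = G0 *\<^sub>v (F *\<^sub>v y)" using assoc_mult_mat_vec[OF G0 F y] by simp
      finally show ?thesis .
    qed
    have "?G *\<^sub>v x = s \<cdot>\<^sub>v (G0 *\<^sub>v x) + (1 - s) \<cdot>\<^sub>v (G1 *\<^sub>v x)"
      using G0 G1c x(1) by (intro eq_vecI) (simp_all add: add_scalar_prod_distrib[of _ n])
    also have "\<dots> = G0 *\<^sub>v (s \<cdot>\<^sub>v x + (1 - s) \<cdot>\<^sub>v (F *\<^sub>v y))"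
      unfolding G1x using G0 x(1) Fy
      by (simp add: mult_add_distrib_mat_vec[of _ n n] mult_mat_vec)
    finally have "G0 *\<^sub>v (s \<cdot>\<^sub>v x + (1 - s) \<cdot>\<^sub>v (F *\<^sub>v y)) = 0\<^sub>v n" using x(3) by simp
    then have zero: "s \<cdot>\<^sub>v x + (1 - s) \<cdot>\<^sub>v (F *\<^sub>v y) = 0\<^sub>v n"
      using G0_reg det_0_iff_vec_prod_zero_field[OF G0] add_carrier_vec[of _ n] x(1) Fy
      by (meson smult_carrier_vec)
    have eq: "s * x $ i + (1 - s) * (F *\<^sub>v y) $ i = 0" if "i < n" for i
      using arg_cong[OF zero, of "\<lambda>v. v $ i"] that x(1) carrier_vecD[OF Fy] by (simp del: index_mult_mat_vec)
    have "Z *\<^sub>v (s \<cdot>\<^sub>v x + (1 - s) \<cdot>\<^sub>v (F *\<^sub>v y)) = s \<cdot>\<^sub>v y + (1 - s) \<cdot>\<^sub>v ((Z * F) *\<^sub>v y)"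
      using Z x(1) Fy assoc_mult_mat_vec[OF Z F y]
      by (simp add: mult_add_distrib_mat_vec[of _ k n] mult_mat_vec y_def)
    also have "\<dots> = y" unfolding ZF using y by (intro eq_vecI) (auto simp: algebra_simps)
    finally have "y = Z *\<^sub>v 0\<^sub>v n"
      using zero by simp
    then have "F *\<^sub>v y = 0\<^sub>v n" using Z F by (intro eq_vecI) (auto simp: scalar_prod_def)
    then have "x $ i = 0" if "i < n" for i using eq[OF that] s that by simp
    then have "x = 0\<^sub>v n" using x(1) by (intro eq_vecI) auto
    with x show False by blast
  qed
qed

section \<open>Cyclic intervals\<close>

text \<open>The row sets in the entries of column \<open>j\<close> are \<open>cyclic_preds n (k - 1) j\<close>, enlarged by one row,
  and \<open>cyclic_preds n k j\<close>; treating the length as a parameter covers both.\<close>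
definition cyclic_preds :: "nat \<Rightarrow> nat \<Rightarrow> nat \<Rightarrow> nat set" where
  "cyclic_preds n m j = residue n ` {int j - int m .. int j - 1}"

lemma cyclic_preds_eq:
  assumes "1 \<le> j" "j \<le> n" "m \<le> n"
  shows "cyclic_preds n m j = (if m < j then {j - m..<j} else {1..<j} \<union> {n + j - m..n})"
proof -
  have low: "residue n x = nat x" if "1 \<le> x" "x \<le> int n" for x
  proof -
    have "(x - 1) mod int n = x - 1" using that by (intro mod_pos_pos_trivial) auto
    then show ?thesis using that by (simp add: residue_def)
  qed
  have high: "residue n x = nat (x + int n)" if "1 - int n \<le> x" "x \<le> 0" for x
  proof -
    have "(x - 1) mod int n = (x - 1 + int n) mod int n" by simp
    also have "\<dots> = x - 1 + int n" using that by (intro mod_pos_pos_trivial) auto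
    finally show ?thesis using that by (simp add: residue_def)
  qed
  show ?thesis
  proof (cases "m < j")
    case True
    have "cyclic_preds n m j = nat ` {int j - int m .. int j - 1}"
      unfolding cyclic_preds_def using True assms by (intro image_cong) (auto intro!: low)
    also have "\<dots> = {j - m..<j}"
    proof (intro equalityI subsetI)
      fix x assume "x \<in> {j - m..<j}"
      then show "x \<in> nat ` {int j - int m .. int j - 1}"
        using True by (intro image_eqI[of _ _ "int x"]) auto
    qed (use True in auto)
    finally show ?thesis using True by simp
  next
    case False
    then have "{int j - int m .. int j - 1} = {1..int j - 1} \<union> {int j - int m .. 0}"
      using assms by auto
    then have "cyclic_preds n m j = residue n ` {1..int j - 1} \<union> residue n ` {int j - int m .. 0}"
      by (simp add: cyclic_preds_def image_Un)
    also have "residue n ` {1..int j - 1} = nat ` {1..int j - 1}"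
      using assms by (intro image_cong) (auto intro!: low)
    also have "\<dots> = {1..<j}"
    proof (intro equalityI subsetI)
      fix x assume "x \<in> {1..<j}"
      then show "x \<in> nat ` {1..int j - 1}"
        by (intro image_eqI[of _ _ "int x"]) auto
    qed (use assms in auto)
    also have "residue n ` {int j - int m .. 0} = (\<lambda>x. nat (x + int n)) ` {int j - int m .. 0}"
      using assms by (intro image_cong) (auto intro!: high)
    also have "\<dots> = {n + j - m..n}"
    proof (intro equalityI subsetI)
      fix x assume "x \<in> {n + j - m..n}"
      then show "x \<in> (\<lambda>x. nat (x + int n)) ` {int j - int m .. 0}"
        using assms by (intro image_eqI[of _ _ "int x - int n"]) auto
    qed (use assms in auto)
    finally show ?thesis using False by simp
  qed
qed

lemma cyclic_preds_subset:
  "1 \<le> j \<Longrightarrow> j \<le> n \<Longrightarrow> m \<le> n \<Longrightarrow> cyclic_preds n m j \<subseteq> {1..n}"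
  by (auto simp: cyclic_preds_eq split: if_splits)

lemma card_cyclic_preds:
  assumes "1 \<le> j" "j \<le> n" "m \<le> n"
  shows "card (cyclic_preds n m j) = m"
proof (cases "m < j")
  case False
  have "card ({1..<j} \<union> {n + j - m..n}) = (j - 1) + (Suc n - (n + j - m))"
    using assms by (subst card_Un_disjoint) auto
  then show ?thesis using assms False by (simp add: cyclic_preds_eq)
qed (use assms in \<open>simp add: cyclic_preds_eq\<close>)

lemma not_in_cyclic_preds_self:
  "1 \<le> j \<Longrightarrow> j \<le> n \<Longrightarrow> m < n \<Longrightarrow> j \<notin> cyclic_preds n m j"
  by (auto simp: cyclic_preds_eq)

text \<open>This is the exponent of the sign met when \<open>i\<close> is inserted into the cyclic interval. When the
  interval wraps around, every admissible \<open>i\<close> lies in the gap between its two pieces, so the sign does not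
  depend on \<open>i\<close>; otherwise \<open>i\<close> lies on one of two sides of it.\<close>
lemma card_cyclic_preds_less:
  assumes "1 \<le> j" "j \<le> n" "m < n" "1 \<le> i" "i \<le> n" "i \<notin> cyclic_preds n m j"
  shows "card {s \<in> cyclic_preds n m j. s < i} = (if j \<le> m then j - 1 else if j \<le> i then m else 0)"
proof (cases "j \<le> m")
  case True
  then have "cyclic_preds n m j = {1..<j} \<union> {n + j - m..n}" using assms by (simp add: cyclic_preds_eq)
  moreover from this have "j \<le> i" "i < n + j - m" using assms(4-6) by simp_all
  ultimately have "{s \<in> cyclic_preds n m j. s < i} = {1..<j}" by force
  then show ?thesis using True by simp
next
  case False
  then have b: "cyclic_preds n m j = {j - m..<j}" using assms by (simp add: cyclic_preds_eq)
  show ?thesis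
  proof (cases "j \<le> i")
    case True
    then have "{s \<in> cyclic_preds n m j. s < i} = {j - m..<j}" unfolding b by auto
    then show ?thesis using False True by simp
  next
    case less: False
    then have "{s \<in> cyclic_preds n m j. s < i} = {}" using assms(6) unfolding b by auto
    then show ?thesis using False less by simp
  qed
qed

section \<open>Specializing the indeterminate\<close>

definition g_ratio :: "nat \<Rightarrow> nat \<Rightarrow> complex vec set \<Rightarrow> nat \<Rightarrow> nat \<Rightarrow> complex" where
  "g_ratio n k N i j =
     plucker_mod n k N ({int j - int k + 1 .. int j - 1} \<union> {int i}) /
     plucker_mod n k N {int j - int k .. int j - 1}"

lemma g_ratio_eq:
  assumes "1 \<le> k" "k < n" "1 \<le> j" "j \<le> n" "1 \<le> i" "i \<le> n"
  shows "g_ratio n k N i j =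
    (if i \<in> cyclic_preds n (k - 1) j then 0 else plucker n k N (insert i (cyclic_preds n (k - 1) j)))
      / plucker n k N (cyclic_preds n k j)"
proof -
  have "(int i - 1) mod int n = int i - 1" using assms by (intro mod_pos_pos_trivial) auto
  then have i: "residue n (int i) = i" using assms by (simp add: residue_def)
  have k1: "int j - int k + 1 = int j - int (k - 1)" using assms by simp
  have num: "residue n ` ({int j - int k + 1 .. int j - 1} \<union> {int i}) =
      insert i (cyclic_preds n (k - 1) j)"
    unfolding k1 cyclic_preds_def image_Un image_insert image_empty i by simp
  have den: "residue n ` {int j - int k .. int j - 1} = cyclic_preds n k j"
    by (simp add: cyclic_preds_def)
  have fin: "finite (cyclic_preds n (k - 1) j)" by (simp add: cyclic_preds_def)
  have "card (insert i (cyclic_preds n (k - 1) j)) = (if i \<in> cyclic_preds n (k - 1) j then k - 1 else k)"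
    using assms(1-4) fin card_cyclic_preds[of j n "k - 1"] by (simp add: insert_absorb)
  moreover have "card (cyclic_preds n k j) = k" using assms by (simp add: card_cyclic_preds)
  moreover have "k - 1 \<noteq> k" using assms(1) by simp
  ultimately show ?thesis
    unfolding g_ratio_def plucker_mod_def num den by simp
qed

text \<open>All entries of \<open>g_mat\<close> are polynomials in the indeterminate, which makes it possible to
  specialize it to complex numbers. Indices are 0-based here.\<close>
definition g_poly :: "nat \<Rightarrow> nat \<Rightarrow> point \<Rightarrow> complex poly mat" where
  "g_poly n k p = mat n n (\<lambda>(i, j).
     (if j < k then 1 else if j \<le> i then [:snd p:] else [:0, 1:]) *
     [:g_ratio n k (fst p) (Suc i) (Suc j):])"

definition g_at :: "nat \<Rightarrow> nat \<Rightarrow> point \<Rightarrow> complex \<Rightarrow> complex mat" where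
  "g_at n k p \<mu> = map_mat (\<lambda>f. poly f \<mu>) (g_poly n k p)"

lemma g_mat_eq_g_poly: "g_mat n k p = map_mat to_fract (g_poly n k p)"
  by (rule eq_matI) (auto simp: g_mat_def g_poly_def g_entry_def g_ratio_def coeff_c_def simp flip: to_fract_mult)

lemma g_poly_carrier [simp]: "g_poly n k p \<in> carrier_mat n n"
  by (simp add: g_poly_def)

lemma g_at_carrier [simp]: "g_at n k p \<mu> \<in> carrier_mat n n"
  by (simp add: g_at_def)

lemma g_at_dim [simp]: "dim_row (g_at n k p \<mu>) = n" "dim_col (g_at n k p \<mu>) = n"
  by (simp_all add: g_at_def g_poly_def)

lemma g_at_index:
  "i < n \<Longrightarrow> j < n \<Longrightarrow> g_at n k (N, t) \<mu> $$ (i, j) =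
     (if j < k then 1 else if j \<le> i then t else \<mu>) * g_ratio n k N (Suc i) (Suc j)"
  by (simp add: g_at_def g_poly_def)

text \<open>The columns of \<open>g\<close> at \<open>(-1)^(k-1) t\<close> lie in the column space of \<open>A\<close>. Column \<open>j\<close>, counted
  from 0, contains the minors without the signs \<open>(-1)^p\<close> of their coordinate vector. For \<open>j < k\<close> this sign is
  \<open>(-1)^j\<close> throughout; for \<open>j \<ge> k\<close> it is \<open>(-1)^(k-1)\<close> on the entries multiplied by \<open>t\<close> and 1
  on those multiplied by the indeterminate.\<close>
lemma g_at_factor:
  assumes k: "1 \<le> k" "k < n" and A: "A \<in> carrier_mat n k"
    and pl: "\<And>J. J \<subseteq> {1..n} \<Longrightarrow> card J = k \<Longrightarrow> plucker n k N J = minor A J"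
  shows "\<exists>Z \<in> carrier_mat k n. g_at n k (N, t) ((-1) ^ (k - 1) * t) = A * Z"
proof -
  let ?G = "g_at n k (N, t) ((-1) ^ (k - 1) * t)"
  let ?P = "\<lambda>j z. z \<in> carrier_vec k \<and> (\<forall>i<n. ?G $$ (i, j) = (A *\<^sub>v z) $ i)"
  have ex: "\<exists>z. ?P j z" if j: "j < n" for j
  proof -
    let ?S = "cyclic_preds n (k - 1) (Suc j)"
    have S: "?S \<subseteq> {1..n}" using j k by (intro cyclic_preds_subset) auto
    have cS: "Suc (card ?S) = k" using j k by (simp add: card_cyclic_preds)
    obtain w where w: "w \<in> carrier_vec k" and Aw: "\<And>i. i < n \<Longrightarrow> (A *\<^sub>v w) $ i =
      (if Suc i \<in> ?S then 0 else (-1) ^ card {s \<in> ?S. s < Suc i} * minor A (insert (Suc i) ?S))"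
      using signed_minors_in_column_space[OF A S cS] by blast
    \<comment> \<open>The signs common to the column, divided by the normalizing Pluecker coordinate.\<close>
    define c where
      "c = (if j < k then (-1) ^ j else (-1) ^ (k - 1) * t) / plucker n k N (cyclic_preds n k (Suc j))"
    have "?G $$ (i, j) = (A *\<^sub>v (c \<cdot>\<^sub>v w)) $ i" if i: "i < n" for i
    proof (cases "Suc i \<in> ?S")
      case True
      then show ?thesis using i j k A w Aw[OF i] by (simp add: g_at_index g_ratio_eq)
    next
      case False
      have "insert (Suc i) ?S \<subseteq> {1..n}" using S i by auto
      moreover have "card (insert (Suc i) ?S) = k"
        using False cS finite_subset[OF S] by simp
      ultimately have "plucker n k N (insert (Suc i) ?S) = minor A (insert (Suc i) ?S)" by (rule pl)
      moreover have "(if j < k then (-1) ^ j else (-1) ^ (k - 1) * t) * (-1) ^ card {s \<in> ?S. s < Suc i} =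
          (if j < k then 1 else if j \<le> i then t else (-1) ^ (k - 1) * t)"
      proof -
        have "card {s \<in> ?S. s < Suc i} = (if j < k then j else if j \<le> i then k - 1 else 0)"
        proof (cases "Suc j = k")
          \<comment> \<open>The last column without \<open>t\<close> and \<open>\<lambda>\<close>: its interval \<open>{1..k-1}\<close> does not wrap around, but
            nothing lies below it.\<close>
          case True
          then have "j \<le> i" using False i k by (auto simp: cyclic_preds_eq)
          moreover have "\<not> Suc j \<le> k - 1" "k - 1 = j" using True by simp_all
          ultimately show ?thesis
            using card_cyclic_preds_less[of "Suc j" n "k - 1" "Suc i"] False i j k by simp
        next
          case noteq: False
          then have "Suc j \<le> k - 1 \<longleftrightarrow> j < k" by linarith
          then show ?thesis
            using card_cyclic_preds_less[of "Suc j" n "k - 1" "Suc i"] False i j k by simp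
        qed
        then show ?thesis by (simp add: mult_ac)
      qed
      moreover have "(A *\<^sub>v (c \<cdot>\<^sub>v w)) $ i = c * (A *\<^sub>v w) $ i"
        using A w i by simp
      ultimately show ?thesis
        using i j k Aw[OF i] False unfolding c_def by (simp add: g_at_index g_ratio_eq)
    qed
    then show ?thesis using w by (intro exI[of _ "c \<cdot>\<^sub>v w"]) simp
  qed
  define z where "z j = (SOME z. ?P j z)" for j
  have "?P j (z j)" if "j < n" for j
    unfolding z_def using ex[OF that] by (rule someI_ex)
  then have z: "\<And>j. j < n \<Longrightarrow> z j \<in> carrier_vec k"
    "\<And>i j. i < n \<Longrightarrow> j < n \<Longrightarrow> ?G $$ (i, j) = (A *\<^sub>v z j) $ i"
    by simp_all
  let ?Z = "mat_of_cols k (map z [0..<n])"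
  have "?Z \<in> carrier_mat k n" by (simp add: mat_of_cols_def)
  moreover have "?G = A * ?Z"
  proof (rule eq_matI)
    fix i j assume "i < dim_row (A * ?Z)" "j < dim_col (A * ?Z)"
    then have "i < n" "j < n" using A by auto
    then show "?G $$ (i, j) = (A * ?Z) $$ (i, j)"
      using A z by simp
  qed (use A in simp_all)
  ultimately show ?thesis by blast
qed

text \<open>Above the diagonal an entry either carries the factor \<open>\<lambda> = 0\<close> or has a repeated index in its
  numerator; on the diagonal numerator and denominator are Pluecker coordinates of \<open>k\<close>-element cyclic
  intervals, hence nonzero.\<close>
lemma det_g_at_0:
  assumes k: "1 \<le> k" "k < n" and t: "t \<noteq> 0"
    and pl: "\<And>J. J \<subseteq> {1..n} \<Longrightarrow> card J = k \<Longrightarrow> plucker n k N J \<noteq> 0"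
  shows "det (g_at n k (N, t) 0) \<noteq> 0"
proof -
  let ?G = "g_at n k (N, t) 0"
  have "?G $$ (i, j) = 0" if "i < j" "j < n" for i j
    using that k by (auto simp: g_at_index g_ratio_eq cyclic_preds_eq)
  then have "det ?G = prod_list (diag_mat ?G)"
    by (intro det_lower_triangular[of n]) auto
  moreover have "?G $$ (j, j) \<noteq> 0" if j: "j < n" for j
  proof -
    let ?S = "cyclic_preds n (k - 1) (Suc j)"
    have notin: "Suc j \<notin> ?S" using j k by (intro not_in_cyclic_preds_self) auto
    have S: "?S \<subseteq> {1..n}" "card ?S = k - 1"
      using cyclic_preds_subset[of "Suc j" n "k - 1"] card_cyclic_preds[of "Suc j" n "k - 1"] j k by simp_all
    have "plucker n k N (insert (Suc j) ?S) \<noteq> 0"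
      using S notin j k finite_subset[OF S(1)] by (intro pl) auto
    moreover have "plucker n k N (cyclic_preds n k (Suc j)) \<noteq> 0"
      using j k by (intro pl cyclic_preds_subset card_cyclic_preds) auto
    moreover have "?G $$ (j, j) = (if j < k then 1 else t) *
        (plucker n k N (insert (Suc j) ?S) / plucker n k N (cyclic_preds n k (Suc j)))"
      using notin j k by (simp add: g_at_index g_ratio_eq)
    ultimately show ?thesis using t by simp
  qed
  then have "0 \<notin> set (diag_mat ?G)"
    unfolding diag_mat_def by force
  ultimately show ?thesis
    by (simp add: prod_list_zero_iff)
qed

text \<open>A factor is singular at exactly one point, and there its column space is the subspace it comes
  from.\<close>
lemma g_at_spectral:
  assumes k: "1 \<le> k" "k < n" and t: "t \<noteq> 0" and N: "N \<in> Gr k n"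
    and pl: "\<And>J. J \<subseteq> {1..n} \<Longrightarrow> card J = k \<Longrightarrow> plucker n k N J \<noteq> 0"
  shows "vec_space.col_space n (g_at n k (N, t) ((-1) ^ (k - 1) * t)) = N"
    and "\<mu> \<noteq> (-1) ^ (k - 1) * t \<Longrightarrow> det (g_at n k (N, t) \<mu>) \<noteq> 0"
proof -
  define A where "A = (SOME A. spans n k A N)"
  have "spans n k A N" unfolding A_def using N by (auto simp: Gr_iff_spans intro: someI_ex)
  then have A: "A \<in> carrier_mat n k" and AN: "vec_space.col_space n A = N" by (auto simp: spans_def)
  let ?c = "(-1) ^ (k - 1) * t"
  let ?G0 = "g_at n k (N, t) 0" and ?G1 = "g_at n k (N, t) ?c"
  have c: "?c \<noteq> 0" using t by simp
  obtain Z where Z: "Z \<in> carrier_mat k n" "?G1 = A * Z"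
    using g_at_factor[OF k A] by (auto simp: plucker_def A_def)
  \<comment> \<open>Multiplication by \<open>E\<close> selects the first \<open>k\<close> columns, the ones free of the indeterminate.\<close>
  define E :: "complex mat" where "E = mat n k (\<lambda>(i, j). if i = j then 1 else 0)"
  have E: "E \<in> carrier_mat n k" by (simp add: E_def)
  have "col E j = unit_vec n j" if "j < k" for j
    using that k by (intro eq_vecI) (auto simp: E_def)
  then have "(g_at n k (N, t) \<mu> * E) $$ (i, j) = g_at n k (N, t) \<mu> $$ (i, j)" if "i < n" "j < k" for i j \<mu>
    using that k E by simp
  then have agree: "?G0 * E = ?G1 * E"
    using k E by (intro eq_matI) (simp_all add: g_at_index)
  have inj: "w = 0\<^sub>v k" if w: "w \<in> carrier_vec k" "E *\<^sub>v w = 0\<^sub>v n" for w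
  proof (rule eq_vecI)
    fix i assume "i < dim_vec (0\<^sub>v k :: complex vec)"
    then have i: "i < k" by simp
    have "(E *\<^sub>v w) $ i = w $ i"
    proof -
      have "row E i = unit_vec k i" using i k by (intro eq_vecI) (auto simp: E_def)
      then show ?thesis using i k w(1) E by simp
    qed
    then show "w $ i = 0\<^sub>v k $ i" using w(2) i k by simp
  qed (use w in auto)
  have reg: "det ?G0 \<noteq> 0" by (rule det_g_at_0[OF k t]) (rule pl)
  note pencil = pencil_col_space_and_det[OF g_at_carrier A Z(1) E Z(2) agree _ reg]
  obtain F where F: "F \<in> carrier_mat n k" "A = ?G1 * F" using pencil(1) inj by blast
  show "vec_space.col_space n ?G1 = N"
    using col_space_mult_subset[OF A Z(1)] col_space_mult_subset[OF g_at_carrier F(1), of k "(N, t)" ?c]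
      Z(2) F(2) AN by simp
  show "det (g_at n k (N, t) \<mu>) \<noteq> 0" if "\<mu> \<noteq> ?c"
  proof -
    \<comment> \<open>\<open>\<mu>\<close> is the affine combination of \<open>0\<close> and \<open>?c\<close> with weights \<open>s\<close> and \<open>1 - s\<close>.\<close>
    define s where "s = 1 - \<mu> / ?c"
    have "s \<noteq> 0" using that c by (simp add: s_def)
    then have "det (s \<cdot>\<^sub>m ?G0 + (1 - s) \<cdot>\<^sub>m ?G1) \<noteq> 0" by (intro pencil(2) inj)
    moreover have "g_at n k (N, t) \<mu> = s \<cdot>\<^sub>m ?G0 + (1 - s) \<cdot>\<^sub>m ?G1"
    proof (rule eq_matI)
      have mu: "\<mu> = (1 - s) * ?c" using c by (simp add: s_def)
      fix i j
      assume "i < dim_row (s \<cdot>\<^sub>m ?G0 + (1 - s) \<cdot>\<^sub>m ?G1)" "j < dim_col (s \<cdot>\<^sub>m ?G0 + (1 - s) \<cdot>\<^sub>m ?G1)"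
      then have ij: "i < n" "j < n" by simp_all
      define a where "a \<nu> = (if j < k then 1 else if j \<le> i then t else \<nu>)" for \<nu>
      have entry: "g_at n k (N, t) \<nu> $$ (i, j) = a \<nu> * g_ratio n k N (Suc i) (Suc j)" for \<nu>
        using ij by (simp add: g_at_index a_def)
      have "a \<mu> = s * a 0 + (1 - s) * a ?c"
        using mu by (simp add: a_def algebra_simps)
      then have "g_at n k (N, t) \<mu> $$ (i, j) = s * ?G0 $$ (i, j) + (1 - s) * ?G1 $$ (i, j)"
        by (subst (1 2 3) entry) (simp add: distrib_right mult.assoc)
      then show "g_at n k (N, t) \<mu> $$ (i, j) = (s \<cdot>\<^sub>m ?G0 + (1 - s) \<cdot>\<^sub>m ?G1) $$ (i, j)"
        using ij by (simp only: index_add_mat index_smult_mat g_at_dim)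
    qed simp_all
    ultimately show ?thesis by (simp only: not_False_eq_True)
  qed
qed

section \<open>Products and their specializations\<close>

definition mat_prod :: "nat \<Rightarrow> ('a \<Rightarrow> 'b :: semiring_1 mat) \<Rightarrow> 'a list \<Rightarrow> 'b mat" where
  "mat_prod n f xs = foldr (*) (map f xs) (1\<^sub>m n)"

lemma mat_prod_simps [simp]:
  "mat_prod n f [] = 1\<^sub>m n"
  "mat_prod n f (x # xs) = f x * mat_prod n f xs"
  by (simp_all add: mat_prod_def)

lemma mat_prod_carrier:
  "(\<And>x. f x \<in> carrier_mat n n) \<Longrightarrow> mat_prod n f xs \<in> carrier_mat n n"
  by (induction xs) (auto intro: mult_carrier_mat)

lemma (in semiring_hom) map_mat_mat_prod:
  assumes f: "\<And>x. f x \<in> carrier_mat n n"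
  shows "map_mat hom (mat_prod n f xs) = mat_prod n (\<lambda>x. map_mat hom (f x)) xs"
proof (induction xs)
  case Nil
  show ?case by (simp add: mat_hom_one)
next
  case (Cons x xs)
  then show ?case using mat_hom_mult[OF f mat_prod_carrier[where f = f, OF f]] by simp
qed

lemma det_mat_prod_nonzero:
  fixes f :: "'a \<Rightarrow> complex mat"
  assumes f: "\<And>x. f x \<in> carrier_mat n n" and "\<And>x. x \<in> set xs \<Longrightarrow> det (f x) \<noteq> 0"
  shows "det (mat_prod n f xs) \<noteq> 0"
  using assms(2)
proof (induction xs)
  case (Cons x xs)
  then show ?case using det_mult[OF f mat_prod_carrier[where f = f, OF f]] by simp
qed simp

text \<open>Both products come from polynomial matrices, and polynomials embed into their fraction field, so
  the equality holds for polynomials and can be evaluated.\<close>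
lemma g_prod_specialize:
  assumes "g_prod n d k p = g_prod n d k q"
  shows "mat_prod n (\<lambda>i. g_at n (k i) (p i) \<mu>) [1..<Suc d] =
    mat_prod n (\<lambda>i. g_at n (k i) (q i) \<mu>) [1..<Suc d]"
proof -
  interpret F: semiring_hom "to_fract :: complex poly \<Rightarrow> complex poly fract"
    by unfold_locales simp_all
  interpret P: semiring_hom "\<lambda>f :: complex poly. poly f \<mu>"
    by unfold_locales simp_all
  let ?L = "\<lambda>p. mat_prod n (\<lambda>i. g_poly n (k i) (p i)) [1..<Suc d]"
  have lift: "g_prod n d k p = map_mat to_fract (?L p)" for p
    unfolding g_prod_def g_mat_eq_g_poly
    using F.map_mat_mat_prod[of "\<lambda>i. g_poly n (k i) (p i)" n "[1..<Suc d]"]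
    by (simp add: mat_prod_def del: upt_Suc)
  have ev: "map_mat (\<lambda>f. poly f \<mu>) (?L p) = mat_prod n (\<lambda>i. g_at n (k i) (p i) \<mu>) [1..<Suc d]" for p
    unfolding g_at_def using P.map_mat_mat_prod[of "\<lambda>i. g_poly n (k i) (p i)" n] by simp
  have eq: "map_mat to_fract (?L p) = map_mat to_fract (?L q)" using assms by (simp only: lift)
  have "?L p = ?L q"
  proof (rule eq_matI)
    have car: "?L p \<in> carrier_mat n n" for p by (rule mat_prod_carrier) simp
    show "dim_row (?L p) = dim_row (?L q)" "dim_col (?L p) = dim_col (?L q)"
      using carrier_matD[OF car] by (simp_all del: upt_Suc)
    fix i j assume "i < dim_row (?L q)" "j < dim_col (?L q)"
    then have ij: "i < n" "j < n" using carrier_matD[OF car] by (simp_all del: upt_Suc)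
    have "to_fract (?L p $$ (i, j)) = to_fract (?L q $$ (i, j))"
      using arg_cong[OF eq, of "\<lambda>X. X $$ (i, j)"] ij carrier_matD[OF car]
      by (simp del: upt_Suc to_fract_eq_iff)
    then show "?L p $$ (i, j) = ?L q $$ (i, j)" by (simp only: to_fract_eq_iff)
  qed
  then have "map_mat (\<lambda>f. poly f \<mu>) (?L p) = map_mat (\<lambda>f. poly f \<mu>) (?L q)" by (rule arg_cong)
  then show ?thesis unfolding ev .
qed

lemma signed_pos_real_eq:
  assumes "pos_real s" "pos_real t" "(-1) ^ a * s = (-1) ^ b * t"
  shows "s = t"
proof -
  have real: "z = complex_of_real (cmod z)" if "pos_real z" for z
    using that by (auto simp: pos_real_def complex_is_Real_iff complex_eq_iff cmod_eq_Re)
  have cmod: "cmod s = cmod t"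
    using arg_cong[OF assms(3), of cmod] by (simp add: norm_mult norm_power)
  have "s = complex_of_real (cmod s)" using real[OF assms(1)] .
  also have "\<dots> = complex_of_real (cmod t)" unfolding cmod ..
  also have "\<dots> = t" using real[OF assms(2)] by (rule sym)
  finally show ?thesis .
qed

lemma UU_memberD:
  assumes "(\<lambda>i\<in>{1..d}. (N i, t i)) \<in> UU n d k" "i \<in> {1..d}"
  shows "N i \<in> Gr (k i) n" "pos_real (t i)"
    "\<And>J. J \<subseteq> {1..n} \<Longrightarrow> card J = k i \<Longrightarrow> plucker n (k i) (N i) J \<noteq> 0"
proof -
  let ?p = "\<lambda>i\<in>{1..d}. (N i, t i)"
  have p: "?p \<in> (\<Pi>\<^sub>E i\<in>{1..d}. XX n (k i))" "\<forall>i\<in>{1..d}. positive n (k i) (?p i)"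
    using assms(1) unfolding UU_def mem_Collect_eq by blast+
  have pi: "?p i = (N i, t i)" using assms(2) by (rule restrict_apply')
  show "N i \<in> Gr (k i) n"
    using PiE_mem[OF p(1) assms(2)] unfolding pi XX_def by blast
  have pos: "positive n (k i) (N i, t i)"
    using bspec[OF p(2) assms(2)] unfolding pi .
  then show "pos_real (t i)" by (simp add: positive_def)
  obtain c where "\<forall>J. J \<subseteq> {1..n} \<and> card J = k i \<longrightarrow> pos_real (c * plucker n (k i) (N i) J)"
    using pos unfolding positive_def fst_conv by (elim conjE exE)
  then have "pos_real (c * plucker n (k i) (N i) J)" if "J \<subseteq> {1..n}" "card J = k i" for J
    using that by simp
  moreover have "\<not> pos_real (c * 0)" by (simp add: pos_real_def)
  ultimately show "plucker n (k i) (N i) J \<noteq> 0" if "J \<subseteq> {1..n}" "card J = k i" for J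
    using that by metis
qed

section \<open>Injectivity\<close>

theorem corollary5p8:
  fixes n d :: nat
    and k :: "nat \<Rightarrow> nat"
    and M N :: "nat \<Rightarrow> complex vec set"
    and t :: "nat \<Rightarrow> complex"
  assumes "n \<ge> 2" and "d \<ge> 1"
    and "\<forall>i\<in>{1..d}. k i \<in> {1..n - 1}"
    and "(\<lambda>i\<in>{1..d}. (M i, t i)) \<in> UU n d k"
    and "(\<lambda>i\<in>{1..d}. (N i, t i)) \<in> UU n d k"
    and "g_prod n d k (\<lambda>i. (M i, t i)) = g_prod n d k (\<lambda>i. (N i, t i))"
  shows "\<forall>i\<in>{1..d}. M i = N i"
proof -
  define c where "c i = (-1) ^ (k i - 1) * t i" for i
  define G where "G X i \<mu> = g_at n (k i) (X i, t i) \<mu>" for X i \<mu>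
  define P where "P X i \<mu> = mat_prod n (\<lambda>l. G X l \<mu>) [i..<Suc d]" for X i \<mu>
  have k: "1 \<le> k i" "k i < n" if "i \<in> {1..d}" for i
  proof -
    have "1 \<le> k i" "k i \<le> n - 1" using bspec[OF assms(3) that] by simp_all
    then show "1 \<le> k i" "k i < n" using assms(1) by linarith+
  qed
  have pos: "pos_real (t i)" if "i \<in> {1..d}" for i
    using UU_memberD(2)[OF assms(4) that] .
  then have t: "t i \<noteq> 0" if "i \<in> {1..d}" for i
    using pos[OF that] unfolding pos_real_def by force
  have "inj_on (\<lambda>i. snd ((\<lambda>i\<in>{1..d}. (M i, t i)) i)) {1..d}"
    using assms(4) unfolding UU_def mem_Collect_eq by blast
  then have "inj_on t {1..d}"
    by (rule inj_on_cong[THEN iffD1, rotated]) simp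
  then have c_distinct: "i = j" if "i \<in> {1..d}" "j \<in> {1..d}" "c i = c j" for i j
    using signed_pos_real_eq[OF pos pos that(3)[unfolded c_def]] that by (auto dest: inj_onD)
  have G_carrier: "G X i \<mu> \<in> carrier_mat n n" for X i \<mu> by (simp add: G_def)
  have P_carrier: "P X i \<mu> \<in> carrier_mat n n" for X i \<mu>
    unfolding P_def by (rule mat_prod_carrier) (rule G_carrier)
  have P_step: "P X i \<mu> = G X i \<mu> * P X (Suc i) \<mu>" if "i \<in> {1..d}" for X i \<mu>
    using that by (simp add: P_def upt_conv_Cons del: upt_Suc)
  have space: "vec_space.col_space n (G X i (c i)) = X i"
    and nonsing: "\<And>\<mu>. \<mu> \<noteq> c i \<Longrightarrow> det (G X i \<mu>) \<noteq> 0"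
    if "X \<in> {M, N}" and i: "i \<in> {1..d}" for X i
  proof -
    have X: "(\<lambda>i\<in>{1..d}. (X i, t i)) \<in> UU n d k" using that(1) assms(4,5) by auto
    note spectral = g_at_spectral[OF k[OF that(2)] t[OF that(2)] UU_memberD(1)[OF X that(2)]]
    show "vec_space.col_space n (G X i (c i)) = X i"
      unfolding G_def c_def by (rule spectral(1)) (rule UU_memberD(3)[OF X that(2)])
    show "det (G X i \<mu>) \<noteq> 0" if "\<mu> \<noteq> c i" for \<mu>
      unfolding G_def by (rule spectral(2)) (use that UU_memberD(3)[OF X i] in \<open>simp_all add: c_def\<close>)
  qed
  have P_space: "vec_space.col_space n (P X i (c i)) = X i" if X: "X \<in> {M, N}" and i: "i \<in> {1..d}" for X i
  proof -
    have "det (P X (Suc i) (c i)) \<noteq> 0"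
      unfolding P_def
    proof (rule det_mat_prod_nonzero[OF G_carrier])
      fix l assume "l \<in> set [Suc i..<Suc d]"
      then have l: "l \<in> {1..d}" "l \<noteq> i" by auto
      then have "c i \<noteq> c l" using c_distinct i by metis
      then show "det (G X l (c i)) \<noteq> 0" by (rule nonsing[OF X l(1)])
    qed
    then show ?thesis
      unfolding P_step[OF i]
      using col_space_mult_nonsingular[OF G_carrier P_carrier] space[OF X i] by simp
  qed
  \<comment> \<open>The first \<open>i\<close> subspaces agree, and so do the remaining products away from the points where
    the cancelled factors are singular.\<close>
  have "(\<forall>j\<in>{1..<Suc i}. M j = N j) \<and> (\<forall>\<mu>. \<mu> \<notin> c ` {1..<Suc i} \<longrightarrow> P M (Suc i) \<mu> = P N (Suc i) \<mu>)"
    if "i \<le> d" for i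
    using that
  proof (induction i)
    case 0
    show ?case
      using g_prod_specialize[OF assms(6)] by (simp add: P_def G_def del: upt_Suc)
  next
    case (Suc i)
    let ?i = "Suc i"
    have i: "?i \<in> {1..d}" using Suc.prems by simp
    have eq_below: "\<forall>j\<in>{1..<?i}. M j = N j"
      and prod: "\<And>\<mu>. \<mu> \<notin> c ` {1..<?i} \<Longrightarrow> P M ?i \<mu> = P N ?i \<mu>"
      using Suc.IH Suc.prems by simp_all
    have "c ?i \<notin> c ` {1..<?i}"
    proof
      assume "c ?i \<in> c ` {1..<?i}"
      then obtain j where "j \<in> {1..<?i}" "c ?i = c j" by blast
      then show False using c_distinct[OF i, of j] i by simp
    qed
    then have MN: "M ?i = N ?i"
      using P_space[of M ?i] P_space[of N ?i] i prod by simp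
    have "P M (Suc ?i) \<mu> = P N (Suc ?i) \<mu>" if \<mu>: "\<mu> \<notin> c ` {1..<Suc ?i}" for \<mu>
    proof (rule mult_left_cancel_nonsingular[OF G_carrier _ P_carrier P_carrier])
      have "\<mu> \<noteq> c ?i" using \<mu> by auto
      then show "det (G M ?i \<mu>) \<noteq> 0" using nonsing[of M ?i] i by simp
      have below: "\<mu> \<notin> c ` {1..<?i}" using \<mu> by auto
      have "G N ?i \<mu> = G M ?i \<mu>" using MN by (simp add: G_def)
      then show "G M ?i \<mu> * P M (Suc ?i) \<mu> = G M ?i \<mu> * P N (Suc ?i) \<mu>"
        using prod[OF below] unfolding P_step[OF i] by simp
    qed
    moreover have "\<forall>j\<in>{1..<Suc ?i}. M j = N j" using eq_below MN by (auto simp: less_Suc_eq)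
    ultimately show ?case by blast
  qed
  from this[OF order_refl] show ?thesis by auto
qed

end
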